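(* For every real number $t$ with $1<t<\sqrt{(2+\sqrt{2})/3}$, the hypersurface $$M_t^3=\{(z_1,z_2,z_3,z_4)\in\mathbb{C}^4:\ |z_1|^2+|z_2|^2+|z_3|^2+|z_4|^2=t\}\cap Q^3,$$ where $Q^3=\{(z_1,z_2,z_3,z_4)\in\mathbb{C}^4:\ z_1^2+z_2^2+z_3^2+z_4^2=1\}$, admits a real-analytic CR-embedding in $\mathbb{C}^3$.
   Context: $Q^3$ is the affine quadric, a 3-dimensional complex submanifold of $\mathbb{C}^4$. For $t>1$, the set $M_t^3$ is a compact real-analytic strongly pseudoconvex real hypersurface in $Q^3$, and it carries the CR-structure induced from the complex manifold $Q^3$: the complex tangent space at $p\in M_t^3$ is the maximal complex subspace $T_pM_t^3\cap J\,T_pM_t^3$ of $T_pQ^3$, where $J$ is the complex structure of $Q^3$. A real-analytic CR-embedding of $M_t^3$ in $\mathbb{C}^3$ is a real-analytic embedding (injective immersion, $M_t^3$ being compact) $M_t^3\to\mathbb{C}^3$ that is a CR-map, i.e. whose differential at each point is complex-linear on the complex tangent space. *)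

theory Defs
  imports "HOL-Analysis.Analysis"
begin

section \<open>Real-analytic maps\<close>

text \<open>Coordinates are taken with respect to the orthonormal basis \<^const>\<open>Basis\<close> of the Euclidean space;
  on \<open>complex ^ 'n\<close> they are the real and imaginary parts of the components. Multi-indices are
  the functions \<^term>\<open>\<alpha>\<close> from the basis to the natural numbers, and \<open>has_sum\<close> is
  unconditional (equivalently, absolute) convergence of the power series.\<close>

definition real_analytic_at :: "('a::euclidean_space \<Rightarrow> 'b::euclidean_space) \<Rightarrow> 'a \<Rightarrow> bool" where
  "real_analytic_at F p \<longleftrightarrow>
     (\<exists>r>0. \<exists>c :: ('a \<Rightarrow> nat) \<Rightarrow> 'b. \<forall>x\<in>ball p r.
        ((\<lambda>\<alpha>. (\<Prod>b\<in>Basis. ((x - p) \<bullet> b) ^ \<alpha> b) *\<^sub>R c \<alpha>) has_sum F x)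
          (Basis \<rightarrow>\<^sub>E (UNIV :: nat set)))"

text \<open>A map on a real-analytic submanifold \<^term>\<open>M\<close> of a Euclidean space is real-analytic iff it is
  locally the restriction of a real-analytic map on an open set of the ambient space.\<close>

definition real_analytic_map_on ::
    "'a::euclidean_space set \<Rightarrow> ('a \<Rightarrow> 'b::euclidean_space) \<Rightarrow> bool" where
  "real_analytic_map_on M f \<longleftrightarrow>
     (\<forall>p\<in>M. \<exists>U F. open U \<and> p \<in> U \<and> (\<forall>x\<in>U. real_analytic_at F x) \<and> (\<forall>x\<in>M \<inter> U. F x = f x))"

section \<open>Tangent spaces, immersions and CR-maps\<close>

definition tangent_space :: "'a::euclidean_space set \<Rightarrow> 'a \<Rightarrow> 'a set" where
  "tangent_space M p =
     {v. \<exists>\<epsilon>>0. \<exists>\<gamma> :: real \<Rightarrow> 'a. \<gamma> C1_differentiable_on {-\<epsilon><..<\<epsilon>} \<and> \<gamma> ` {-\<epsilon><..<\<epsilon>} \<subseteq> M \<and>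
           \<gamma> 0 = p \<and> (\<gamma> has_vector_derivative v) (at 0)}"

text \<open>In the next definitions \<^term>\<open>L\<close> is a derivative of \<^term>\<open>f\<close> at \<^term>\<open>p\<close> within
  \<^term>\<open>M\<close>. It is not unique as a linear map on the ambient space, but by the chain rule along
  curves in \<^term>\<open>M\<close> its restriction to the tangent space of \<^term>\<open>M\<close> at \<^term>\<open>p\<close> is: it is the
  differential of \<^term>\<open>f\<close> at \<^term>\<open>p\<close>. Only this restriction is used.\<close>

definition immersion_on :: "'a::euclidean_space set \<Rightarrow> ('a \<Rightarrow> 'b::euclidean_space) \<Rightarrow> bool" where
  "immersion_on M f \<longleftrightarrow>
     (\<forall>p\<in>M. \<exists>L. (f has_derivative L) (at p within M) \<and> inj_on L (tangent_space M p))"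

text \<open>The maximal complex subspace of the tangent space. The complex structure of a complex
  submanifold of \<open>complex ^ 'n\<close> is multiplication by \<^term>\<open>\<i>\<close> on its tangent spaces.\<close>

definition complex_tangent_space :: "(complex ^ 'n) set \<Rightarrow> complex ^ 'n \<Rightarrow> (complex ^ 'n) set" where
  "complex_tangent_space M p = tangent_space M p \<inter> (\<lambda>v. \<i> *s v) ` tangent_space M p"

definition CR_map_on :: "(complex ^ 'n) set \<Rightarrow> (complex ^ 'n \<Rightarrow> complex ^ 'm) \<Rightarrow> bool" where
  "CR_map_on M f \<longleftrightarrow>
     (\<forall>p\<in>M. \<exists>L. (f has_derivative L) (at p within M) \<and>
        (\<forall>v\<in>complex_tangent_space M p. L (\<i> *s v) = \<i> *s L v))"

text \<open>This is meant for compact \<^term>\<open>M\<close>, where an injective immersion is automatically a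
  homeomorphism onto its image.\<close>

definition real_analytic_CR_embedding ::
    "(complex ^ 'n) set \<Rightarrow> (complex ^ 'n \<Rightarrow> complex ^ 'm) \<Rightarrow> bool" where
  "real_analytic_CR_embedding M f \<longleftrightarrow>
     real_analytic_map_on M f \<and> inj_on f M \<and> immersion_on M f \<and> CR_map_on M f"

section \<open>The hypersurfaces in the affine quadric\<close>

definition Q3 :: "(complex ^ 4) set" where
  "Q3 = {z. (z$1)\<^sup>2 + (z$2)\<^sup>2 + (z$3)\<^sup>2 + (z$4)\<^sup>2 = 1}"

definition M3 :: "real \<Rightarrow> (complex ^ 4) set" where
  "M3 t = {z. (cmod (z$1))\<^sup>2 + (cmod (z$2))\<^sup>2 + (cmod (z$3))\<^sup>2 + (cmod (z$4))\<^sup>2 = t} \<inter> Q3"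

end

theory Submission
  imports Defs
begin

text \<open>In the coordinates \<open>z = z\<^sub>1 + \<i> z\<^sub>2\<close>, \<open>\<zeta> = z\<^sub>1 - \<i> z\<^sub>2\<close>, \<open>w = z\<^sub>3 + \<i> z\<^sub>4\<close>, \<open>\<eta> = z\<^sub>3 - \<i> z\<^sub>4\<close> the quadric is
  \<open>z \<zeta> + w \<eta> = 1\<close>. The embedding is the polynomial map \<open>(z, w, \<zeta> \<eta> (w \<eta> + \<i> z \<zeta>))\<close> of Ahern and Rudin,
  so only injectivity and immersivity are at issue. With \<open>z\<close>, \<open>w\<close> fixed and nonzero the third component is, up
  to the factor \<open>z w\<close>, the cubic \<open>g a = a (1 - a) (1 - a + \<i> a)\<close> in \<open>a = z \<zeta>\<close>, so both properties say that
  the divided differences of \<open>g\<close> (confluent ones included) do not vanish on the circle on which \<open>a\<close> varies.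
  For the mean \<open>m' + 1/2 + \<i>/6\<close> and the half difference \<open>d\<close> of two points, vanishing means
  \<open>3 m'\<^sup>2 + d\<^sup>2 = 1/6\<close>. The confluent case \<open>d = 0\<close> is the worst one, and the critical points of \<open>g\<close> lie
  on no such circle as long as \<open>9 t\<^sup>4 - 12 t\<^sup>2 + 2 < 0\<close>; the larger root \<open>t\<^sup>2 = (2 + sqrt 2) / 3\<close> is the bound.\<close>

section \<open>Polynomial maps, derivatives and tangent vectors\<close>

text \<open>Finite expansions about \<open>p\<close> include constants and coordinate differences
  and are closed under sums and products, so induction over polynomials applies. Finiteness makes
  them convergent power series everywhere.\<close>

lemma real_polynomial_function_expansion:
  fixes f :: "'a::euclidean_space \<Rightarrow> real" and p :: 'a
  assumes "real_polynomial_function f"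
  shows "\<exists>K c. finite K \<and> K \<subseteq> (Basis \<rightarrow>\<^sub>E UNIV) \<and>
           (\<forall>x. f x = (\<Sum>\<alpha>\<in>K. (\<Prod>b\<in>Basis. ((x - p) \<bullet> b) ^ \<alpha> b) * c \<alpha>))"
    (is "?expands f")
proof -
  let ?m = "\<lambda>x \<alpha>. \<Prod>b\<in>Basis. ((x - p) \<bullet> b) ^ \<alpha> b"
  have const: "?expands (\<lambda>x. a)" for a
    by (rule exI[of _ "{\<lambda>b\<in>Basis. 0}"], rule exI[of _ "\<lambda>_. a"]) simp
  have coord: "?expands (\<lambda>x. (x - p) \<bullet> b)" if "b \<in> Basis" for b
  proof -
    have "?m x (\<lambda>b'\<in>Basis. if b' = b then 1 else 0) = (x - p) \<bullet> b" for x
    proof -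
      have "?m x (\<lambda>b'\<in>Basis. if b' = b then 1 else 0) = (\<Prod>b'\<in>Basis. if b' = b then (x - p) \<bullet> b else 1)"
        by (intro prod.cong) auto
      then show ?thesis
        using that by simp
    qed
    then show ?thesis
      by (intro exI[of _ "{\<lambda>b'\<in>Basis. if b' = b then 1 else 0}"] exI[of _ "\<lambda>_. 1"]) simp
  qed
  have add: "?expands (\<lambda>x. g x + h x)" if g: "?expands g" and h: "?expands h" for g h
  proof -
    obtain K c where K: "finite K" "K \<subseteq> (Basis \<rightarrow>\<^sub>E UNIV)" "\<And>x. g x = (\<Sum>\<alpha>\<in>K. ?m x \<alpha> * c \<alpha>)"
      using g by blast
    obtain L e where L: "finite L" "L \<subseteq> (Basis \<rightarrow>\<^sub>E UNIV)" "\<And>x. h x = (\<Sum>\<alpha>\<in>L. ?m x \<alpha> * e \<alpha>)"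
      using h by blast
    have "g x = (\<Sum>\<alpha>\<in>K \<union> L. ?m x \<alpha> * (if \<alpha> \<in> K then c \<alpha> else 0))" for x
      unfolding K(3) using K(1) L(1) by (intro sum.mono_neutral_cong_left) auto
    moreover have "h x = (\<Sum>\<alpha>\<in>K \<union> L. ?m x \<alpha> * (if \<alpha> \<in> L then e \<alpha> else 0))" for x
      unfolding L(3) using K(1) L(1) by (intro sum.mono_neutral_cong_left) auto
    ultimately have "g x + h x = (\<Sum>\<alpha>\<in>K \<union> L. ?m x \<alpha> *
        ((if \<alpha> \<in> K then c \<alpha> else 0) + (if \<alpha> \<in> L then e \<alpha> else 0)))" for x
      by (simp only: sum.distrib distrib_left)
    with K(1,2) L(1,2) show ?thesis
      by (intro exI[of _ "K \<union> L"] exI) auto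
  qed
  have mult: "?expands (\<lambda>x. g x * h x)" if g: "?expands g" and h: "?expands h" for g h
  proof -
    obtain K c where K: "finite K" "K \<subseteq> (Basis \<rightarrow>\<^sub>E UNIV)" "\<And>x. g x = (\<Sum>\<alpha>\<in>K. ?m x \<alpha> * c \<alpha>)"
      using g by blast
    obtain L e where L: "finite L" "L \<subseteq> (Basis \<rightarrow>\<^sub>E UNIV)" "\<And>x. h x = (\<Sum>\<alpha>\<in>L. ?m x \<alpha> * e \<alpha>)"
      using h by blast
    define s :: "('a \<Rightarrow> nat) \<times> ('a \<Rightarrow> nat) \<Rightarrow> 'a \<Rightarrow> nat"
      where "s = (\<lambda>(\<alpha>, \<beta>). \<lambda>b\<in>Basis. \<alpha> b + \<beta> b)"
    have m: "?m x (s i) = ?m x (fst i) * ?m x (snd i)" for x i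
      by (simp add: s_def case_prod_beta power_add prod.distrib)
    \<comment> \<open>Different pairs of multi-indices may have the same sum, so coefficients are
      collected along the fibres of \<open>s\<close>.\<close>
    have "g x * h x = (\<Sum>\<gamma>\<in>s ` (K \<times> L). ?m x \<gamma> * (\<Sum>i | i \<in> K \<times> L \<and> s i = \<gamma>. c (fst i) * e (snd i)))" for x
    proof -
      have "g x * h x = (\<Sum>i\<in>K \<times> L. ?m x (s i) * (c (fst i) * e (snd i)))"
        unfolding m K(3) L(3) by (simp add: sum_product sum.cartesian_product case_prod_beta mult_ac)
      also have "\<dots> = (\<Sum>\<gamma>\<in>s ` (K \<times> L). \<Sum>i | i \<in> K \<times> L \<and> s i = \<gamma>. ?m x (s i) * (c (fst i) * e (snd i)))"
        using K(1) L(1) by (intro sum.image_gen) simp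
      finally show ?thesis
        by (simp add: sum_distrib_left)
    qed
    moreover have "s ` (K \<times> L) \<subseteq> (Basis \<rightarrow>\<^sub>E UNIV)"
      by (auto simp: s_def)
    ultimately show ?thesis
      using K(1) L(1) by (intro exI[of _ "s ` (K \<times> L)"] exI) auto
  qed
  show ?thesis
    using assms
  proof induction
    case (linear f)
    \<comment> \<open>The expansion of a linear map about \<open>p\<close> is assembled by induction
      over subsets of the basis.\<close>
    have *: "?expands (\<lambda>x. f p + (\<Sum>b\<in>B. f b * ((x - p) \<bullet> b)))" if "B \<subseteq> Basis" for B
      using finite_subset[OF that finite_Basis] that
    proof induction
      case empty
      show ?case
        using const by simp
    next
      case (insert b B)
      have "?expands (\<lambda>x. f b * ((x - p) \<bullet> b))"
        using insert.prems by (intro mult[OF const coord]) auto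
      moreover have "?expands (\<lambda>x. f p + (\<Sum>b\<in>B. f b * ((x - p) \<bullet> b)))"
        using insert by simp
      ultimately have "?expands (\<lambda>x. f b * ((x - p) \<bullet> b) + (f p + (\<Sum>b\<in>B. f b * ((x - p) \<bullet> b))))"
        by (rule add)
      then show ?case
        unfolding sum.insert[OF insert.hyps] by (simp only: add.left_commute)
    qed
    have eq: "f p + (\<Sum>b\<in>Basis. f b * ((x - p) \<bullet> b)) = f x" for x
    proof -
      interpret bounded_linear f by (fact linear)
      have "f (x - p) = f (\<Sum>b\<in>Basis. ((x - p) \<bullet> b) *\<^sub>R b)"
        by (simp add: euclidean_representation)
      also have "\<dots> = (\<Sum>b\<in>Basis. f b * ((x - p) \<bullet> b))"
        unfolding sum by (simp add: scaleR mult.commute)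
      finally show ?thesis
        by (simp add: diff)
    qed
    show ?case
      using *[OF order_refl] unfolding eq .
  next
    case (const a)
    show ?case
      by (rule \<open>\<And>a. ?expands (\<lambda>x. a)\<close>)
  next
    case (add f g)
    show ?case
      by (rule \<open>\<And>g h. ?expands g \<Longrightarrow> ?expands h \<Longrightarrow> ?expands (\<lambda>x. g x + h x)\<close>) fact+
  next
    case (mult f g)
    show ?case
      by (rule \<open>\<And>g h. ?expands g \<Longrightarrow> ?expands h \<Longrightarrow> ?expands (\<lambda>x. g x * h x)\<close>) fact+
  qed
qed

lemma real_analytic_at_polynomial_function:
  fixes F :: "'a::euclidean_space \<Rightarrow> 'b::euclidean_space"
  assumes "polynomial_function F"
  shows "real_analytic_at F p"
proof -
  let ?m = "\<lambda>x \<alpha>. \<Prod>b\<in>Basis. ((x - p) \<bullet> b) ^ \<alpha> b"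
  define expansion where "expansion b K c \<longleftrightarrow> finite K \<and> K \<subseteq> (Basis \<rightarrow>\<^sub>E UNIV) \<and>
      (\<forall>x. F x \<bullet> b = (\<Sum>\<alpha>\<in>K. ?m x \<alpha> * c \<alpha>))" for b K c
  have "\<exists>K c. expansion b K c" for b
  proof -
    have "real_polynomial_function (\<lambda>x. F x \<bullet> b)"
      using assms bounded_linear_inner_left[of b] by (auto simp: polynomial_function_def o_def)
    then show ?thesis
      unfolding expansion_def by (rule real_polynomial_function_expansion)
  qed
  then obtain K c where "\<And>b. expansion b (K b) (c b)"
    by metis
  then have K: "\<And>b. finite (K b)" "\<And>b. K b \<subseteq> (Basis \<rightarrow>\<^sub>E UNIV)"
      and F: "\<And>b x. F x \<bullet> b = (\<Sum>\<alpha>\<in>K b. ?m x \<alpha> * c b \<alpha>)"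
    by (simp_all add: expansion_def)
  \<comment> \<open>\<open>L\<close> is a common support for all components; \<open>e\<close> pads
    missing coefficients with zero.\<close>
  define L where "L = (\<Union>b\<in>Basis. K b)"
  define e where "e \<alpha> = (\<Sum>b\<in>Basis. (if \<alpha> \<in> K b then c b \<alpha> else 0) *\<^sub>R b)" for \<alpha>
  have L: "finite L" "L \<subseteq> (Basis \<rightarrow>\<^sub>E UNIV)"
    using K unfolding L_def by auto
  have "F x = (\<Sum>\<alpha>\<in>L. ?m x \<alpha> *\<^sub>R e \<alpha>)" for x
  proof -
    have "F x = (\<Sum>b\<in>Basis. (F x \<bullet> b) *\<^sub>R b)"
      by (simp add: euclidean_representation)
    also have "\<dots> = (\<Sum>b\<in>Basis. (\<Sum>\<alpha>\<in>L. ?m x \<alpha> * (if \<alpha> \<in> K b then c b \<alpha> else 0)) *\<^sub>R b)"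
    proof (intro sum.cong refl arg_cong2[where f = scaleR])
      fix b :: 'b assume "b \<in> Basis"
      then show "F x \<bullet> b = (\<Sum>\<alpha>\<in>L. ?m x \<alpha> * (if \<alpha> \<in> K b then c b \<alpha> else 0))"
        unfolding F using L(1) by (intro sum.mono_neutral_cong_left) (auto simp: L_def)
    qed
    also have "\<dots> = (\<Sum>\<alpha>\<in>L. ?m x \<alpha> *\<^sub>R e \<alpha>)"
      unfolding e_def scaleR_sum_left scaleR_sum_right by (subst sum.swap) simp
    finally show ?thesis .
  qed
  moreover have "e \<alpha> = 0" if "\<alpha> \<notin> L" for \<alpha>
    using that unfolding e_def L_def by (intro sum.neutral) auto
  ultimately have "((\<lambda>\<alpha>. ?m x \<alpha> *\<^sub>R e \<alpha>) has_sum F x) (Basis \<rightarrow>\<^sub>E UNIV)" for x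
    using L by (intro has_sum_finite_neutralI[of L]) auto
  then show ?thesis
    unfolding real_analytic_at_def by (intro exI[of _ 1]) auto
qed

section \<open>Closure properties of polynomial maps\<close>

lemma polynomial_function_compose_bounded_linear:
  fixes f :: "'a::real_normed_vector \<Rightarrow> 'b::real_normed_vector" and h :: "'b \<Rightarrow> 'c::real_normed_vector"
  assumes "polynomial_function f" "bounded_linear h"
  shows "polynomial_function (\<lambda>x. h (f x))"
  unfolding polynomial_function_def
proof (intro allI impI)
  fix k :: "'c \<Rightarrow> real" assume "bounded_linear k"
  then have "bounded_linear (\<lambda>y. k (h y))"
    using assms(2) by (rule bounded_linear_compose)
  then show "real_polynomial_function (k \<circ> (\<lambda>x. h (f x)))"
    using assms(1) by (auto simp: polynomial_function_def o_def)
qed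

lemma polynomial_function_complex_mult:
  fixes f g :: "'a::real_normed_vector \<Rightarrow> complex"
  assumes "polynomial_function f" "polynomial_function g"
  shows "polynomial_function (\<lambda>x. f x * g x)"
proof -
  have "(\<lambda>x. f x * g x) = (\<lambda>x. Re (f x) *\<^sub>R g x + Im (f x) *\<^sub>R (\<i> * g x))"
    by (auto simp: complex_eq_iff)
  moreover have "polynomial_function (\<lambda>x. Re (f x))" "polynomial_function (\<lambda>x. Im (f x))"
      "polynomial_function (\<lambda>x. \<i> * g x)"
    using assms by (auto intro: polynomial_function_compose_bounded_linear
      bounded_linear_Re bounded_linear_Im bounded_linear_mult_right)
  ultimately show ?thesis
    using assms(2) by (simp add: polynomial_function_add polynomial_function_mult)
qed

lemma polynomial_function_componentwise_vec:
  fixes f :: "'a::real_normed_vector \<Rightarrow> 'b::euclidean_space ^ 'n"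
  assumes "\<And>i. polynomial_function (\<lambda>x. f x $ i)"
  shows "polynomial_function f"
  unfolding polynomial_function_iff_Basis_inner
proof
  fix b :: "'b ^ 'n" assume "b \<in> Basis"
  then obtain i u where "b = axis i u"
    by (auto simp: Basis_vec_def)
  then have "(\<lambda>x. f x \<bullet> b) = (\<lambda>x. f x $ i \<bullet> u)"
    by (simp add: inner_axis)
  then show "real_polynomial_function (\<lambda>x. f x \<bullet> b)"
    using assms[of i] bounded_linear_inner_left[of u] by (auto simp: polynomial_function_def o_def)
qed

section \<open>Derivatives and tangent vectors\<close>

lemma has_derivative_componentwise_vec:
  fixes f :: "'a::real_normed_vector \<Rightarrow> 'b::euclidean_space ^ 'n"
  assumes "\<And>i. ((\<lambda>x. f x $ i) has_derivative (\<lambda>h. f' h $ i)) (at x within S)"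
  shows "(f has_derivative f') (at x within S)"
  unfolding has_derivative_componentwise_within[of f]
proof
  fix b :: "'b ^ 'n" assume "b \<in> Basis"
  then obtain i u where "b = axis i u"
    by (auto simp: Basis_vec_def)
  then show "((\<lambda>x. f x \<bullet> b) has_derivative (\<lambda>h. f' h \<bullet> b)) (at x within S)"
    using has_derivative_inner_left[OF assms[of i], of u] by (simp add: inner_axis)
qed

lemma tangent_space_level_set:
  assumes "v \<in> tangent_space M p" and "(g has_derivative g') (at p)" and "\<And>x. x \<in> M \<Longrightarrow> g x = c"
  shows "g' v = 0"
proof -
  obtain \<epsilon> \<gamma> where \<gamma>: "\<epsilon> > 0" "\<gamma> ` {-\<epsilon><..<\<epsilon>} \<subseteq> M" "\<gamma> 0 = p" "(\<gamma> has_vector_derivative v) (at 0)"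
    using assms(1) unfolding tangent_space_def by blast
  have "((\<lambda>s. g (\<gamma> s)) has_derivative (\<lambda>s. g' (s *\<^sub>R v))) (at 0)"
    using has_derivative_compose[of \<gamma> _ 0 UNIV g g'] \<gamma>(3,4) assms(2)
    unfolding has_vector_derivative_def by simp
  moreover have "((\<lambda>s. g (\<gamma> s)) has_derivative (\<lambda>s. 0)) (at 0)"
  proof (rule has_derivative_transform_within_open[OF has_derivative_const])
    show "open {-\<epsilon><..<\<epsilon>}" "0 \<in> {-\<epsilon><..<\<epsilon>}"
      using \<gamma>(1) by auto
    show "c = g (\<gamma> s)" if "s \<in> {-\<epsilon><..<\<epsilon>}" for s
      using that \<gamma>(2) assms(3) by (metis image_subset_iff)
  qed
  ultimately have "(\<lambda>s. g' (s *\<^sub>R v)) = (\<lambda>s. 0)"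
    by (rule has_derivative_unique)
  then show ?thesis
    by (metis scaleR_one)
qed

section \<open>The cubic on a fibre\<close>

text \<open>With m' = m1 + i m2 and d = d1 + i d2, \<open>re\<close> and \<open>im\<close> say 3
  m'^2 + d^2 = 1/6. Equality is attained at d = 0, m2 = 0, the critical points of the cubic.\<close>

lemma fibre_inequality:
  fixes \<rho> m1 m2 d1 d2 :: real
  assumes "0 \<le> \<rho>" "\<rho> \<le> 1"
    and re: "3 * (m1\<^sup>2 - m2\<^sup>2) + d1\<^sup>2 - d2\<^sup>2 = 1/6" and im: "3 * m1 * m2 + d1 * d2 = 0"
  shows "\<rho> / 18 + 1/36 \<le> \<rho> * m1\<^sup>2 + (m2 + 1/6)\<^sup>2 + d1\<^sup>2 + d2\<^sup>2"
proof -
  have m1: "m1\<^sup>2 = 1/18 + m2\<^sup>2 - d1\<^sup>2/3 + d2\<^sup>2/3"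
    using re by algebra
  have sq: "(m2 + 1/6)\<^sup>2 = m2\<^sup>2 + m2/3 + 1/36"
    by (simp add: power2_eq_square algebra_simps)
  have "0 \<le> \<rho> * (m2\<^sup>2 - d1\<^sup>2/3 + d2\<^sup>2/3) + m2\<^sup>2 + m2/3 + d1\<^sup>2 + d2\<^sup>2"
  proof (cases "m2 \<ge> 0")
    case True
    have "\<rho> * d1\<^sup>2 \<le> d1\<^sup>2"
      using assms(1,2) by (simp add: mult_left_le_one_le)
    moreover have "0 \<le> \<rho> * m2\<^sup>2" "0 \<le> \<rho> * d2\<^sup>2" "0 \<le> d1\<^sup>2" "0 \<le> d2\<^sup>2" "0 \<le> m2\<^sup>2"
      using assms(1,2) by auto
    moreover have "\<rho> * (m2\<^sup>2 - d1\<^sup>2/3 + d2\<^sup>2/3) = \<rho> * m2\<^sup>2 - \<rho> * d1\<^sup>2 / 3 + \<rho> * d2\<^sup>2 / 3"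
      by (simp add: algebra_simps)
    ultimately show ?thesis
      using True by linarith
  next
    case False
    \<comment> \<open>The term m2/3 is now negative. In these variables \<open>re\<close> and
      \<open>im\<close> combine to X * Y = n^2 / 2, so by AM-GM X + Y dominates n.\<close>
    define n X Y where "n = - m2" and "X = d1\<^sup>2 - 3 * n\<^sup>2" and "Y = d2\<^sup>2 + 3 * n\<^sup>2"
    have n: "n > 0"
      using False by (simp add: n_def)
    have "9 * m1\<^sup>2 * n\<^sup>2 = d1\<^sup>2 * d2\<^sup>2"
      using im unfolding n_def by algebra
    then have XY: "X * Y = n\<^sup>2 / 2"
      using m1 unfolding X_def Y_def n_def by algebra
    have "0 < Y"
      using n unfolding Y_def by (smt (verit) zero_le_power2 zero_less_power)
    with XY n have "0 < X"
      by (metis half_gt_zero zero_less_mult_pos2 zero_less_power)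
    have "n\<^sup>2 \<le> (X + Y)\<^sup>2"
    proof -
      have "(X + Y)\<^sup>2 = (X - Y)\<^sup>2 + 4 * (X * Y)"
        by algebra
      then show ?thesis
        using XY by (smt (verit) zero_le_power2 field_sum_of_halves)
    qed
    then have "n \<le> X + Y"
      by (rule power2_le_imp_le) (use \<open>0 < X\<close> \<open>0 < Y\<close> in simp)
    moreover have "2/3 * X \<le> (1 - \<rho>/3) * X" "2/3 * Y \<le> (1 + \<rho>/3) * Y"
      using assms(1,2) \<open>0 < X\<close> \<open>0 < Y\<close> by (auto intro!: mult_right_mono)
    moreover have "0 \<le> n\<^sup>2 * (1 - \<rho>)"
      using assms(1,2) by simp
    ultimately have "0 \<le> n\<^sup>2 * (1 - \<rho>) - n/3 + (1 - \<rho>/3) * X + (1 + \<rho>/3) * Y"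
      using n by linarith
    also have "\<dots> = \<rho> * (m2\<^sup>2 - d1\<^sup>2/3 + d2\<^sup>2/3) + m2\<^sup>2 + m2/3 + d1\<^sup>2 + d2\<^sup>2"
      unfolding X_def Y_def n_def by (simp add: algebra_simps)
    finally show ?thesis .
  qed
  moreover have "\<rho> * m1\<^sup>2 = \<rho> / 18 + \<rho> * (m2\<^sup>2 - d1\<^sup>2/3 + d2\<^sup>2/3)"
    unfolding m1 by (simp add: algebra_simps)
  ultimately show ?thesis
    using sq by linarith
qed

text \<open>In a fibre of the map on \<open>M3 t\<close> with \<open>p = |z|\<^sup>2\<close>, \<open>q = |w|\<^sup>2\<close> the parameter \<open>a\<close> runs through a circle
  with centre \<open>c = p / (p + q)\<close> and squared radius at most \<open>c (1 - c) (t\<^sup>2 - 1)\<close>. The bound comes from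
  averaging this over two points and minimising over \<open>c\<close>.\<close>

lemma fibre_mean_bound:
  fixes t p q :: real and a b :: complex
  assumes "1 < t" "0 < p" "0 < q"
    and a: "(cmod a)\<^sup>2 / p + (cmod (1 - a))\<^sup>2 / q + p + q = 2 * t"
    and b: "(cmod b)\<^sup>2 / p + (cmod (1 - b))\<^sup>2 / q + p + q = 2 * t"
  defines "m \<equiv> (a + b) / 2" and "d \<equiv> (a - b) / 2"
  shows "(t\<^sup>2 - 1) / t\<^sup>2 * (Re m - 1/2)\<^sup>2 + (Im m)\<^sup>2 + (Re d)\<^sup>2 + (Im d)\<^sup>2 \<le> (t\<^sup>2 - 1) / 4"
proof -
  define \<sigma> c where "\<sigma> = p + q" and "c = p / \<sigma>"
  have \<sigma>: "\<sigma> > 0" and c: "0 < c" "c < 1"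
    using assms by (auto simp: \<sigma>_def c_def)
  have p: "p = c * \<sigma>" and q: "q = (1 - c) * \<sigma>"
    using \<sigma> by (auto simp: c_def \<sigma>_def field_simps)
  \<comment> \<open>The left-hand side is |w - c|^2 + c (1 - c), which gives the circle around
    c.\<close>
  have *: "(1 - c) * (cmod w)\<^sup>2 + c * (cmod (1 - w))\<^sup>2 \<le> c * (1 - c) * t\<^sup>2"
    if "(cmod w)\<^sup>2 / p + (cmod (1 - w))\<^sup>2 / q + p + q = 2 * t" for w
  proof -
    have "(1 - c) * (cmod w)\<^sup>2 + c * (cmod (1 - w))\<^sup>2 =
        c * (1 - c) * \<sigma> * ((cmod w)\<^sup>2 / p + (cmod (1 - w))\<^sup>2 / q)"
      using \<sigma> c by (simp add: p q field_simps)
    also have "\<dots> = c * (1 - c) * (\<sigma> * (2 * t - \<sigma>))"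
    proof -
      have "(cmod w)\<^sup>2 / p + (cmod (1 - w))\<^sup>2 / q = 2 * t - \<sigma>"
        using that by (simp add: \<sigma>_def)
      then show ?thesis
        by simp
    qed
    also have "\<sigma> * (2 * t - \<sigma>) = t\<^sup>2 - (t - \<sigma>)\<^sup>2"
      by algebra
    also have "c * (1 - c) * (t\<^sup>2 - (t - \<sigma>)\<^sup>2) \<le> c * (1 - c) * t\<^sup>2"
      using c by (intro mult_left_mono) auto
    finally show ?thesis .
  qed
  define \<mu> \<kappa> N where "\<mu> = Re m - 1/2" and "\<kappa> = c - 1/2" and "N = (Im m)\<^sup>2 + (Re d)\<^sup>2 + (Im d)\<^sup>2"
  \<comment> \<open>By the parallelogram law the mean of |a - c|^2 and |b - c|^2 is |m - c|^2 +
    |d|^2; real parts are measured from 1/2.\<close>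
  have "1/4 + \<mu>\<^sup>2 - 2 * \<kappa> * \<mu> + N = ((1 - c) * (cmod a)\<^sup>2 + c * (cmod (1 - a))\<^sup>2 +
      ((1 - c) * (cmod b)\<^sup>2 + c * (cmod (1 - b))\<^sup>2)) / 2"
    by (simp add: \<mu>_def \<kappa>_def N_def m_def d_def cmod_power2) (simp add: power2_eq_square field_simps)
  also have "\<dots> \<le> c * (1 - c) * t\<^sup>2"
    using *[OF a] *[OF b] by simp
  also have "\<dots> = (1/4 - \<kappa>\<^sup>2) * t\<^sup>2"
    unfolding \<kappa>_def by algebra
  finally have 1: "1/4 + \<mu>\<^sup>2 - 2 * \<kappa> * \<mu> + N \<le> (1/4 - \<kappa>\<^sup>2) * t\<^sup>2" .
  \<comment> \<open>As a function of \<open>\<kappa>\<close>, the expression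
    \<open>\<kappa>\<^sup>2 * t\<^sup>2 - 2 * \<kappa> * \<mu>\<close> is least at
    \<open>\<mu> / t\<^sup>2\<close>; this eliminates the unknown centre.\<close>
  have "0 \<le> (\<kappa> * t - \<mu> / t)\<^sup>2"
    by simp
  also have "\<dots> = \<kappa>\<^sup>2 * t\<^sup>2 - 2 * \<kappa> * \<mu> + \<mu>\<^sup>2 / t\<^sup>2"
    using \<open>1 < t\<close> by (simp add: power2_eq_square field_simps)
  finally have "\<mu>\<^sup>2 - \<mu>\<^sup>2 / t\<^sup>2 + N \<le> (t\<^sup>2 - 1) / 4"
    using 1 by (simp add: algebra_simps)
  moreover have "(t\<^sup>2 - 1) / t\<^sup>2 * \<mu>\<^sup>2 = \<mu>\<^sup>2 - \<mu>\<^sup>2 / t\<^sup>2"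
    using \<open>1 < t\<close> by (simp add: field_simps)
  ultimately show ?thesis
    by (simp add: \<mu>_def N_def)
qed

text \<open>The left-hand side is the divided difference at \<open>a\<close>, \<open>b\<close> of the cubic \<open>g a = a (1 - a) (1 - a + \<i> a)\<close>;
  the case \<open>a = b\<close>, where it is \<open>g' a\<close>, gives the immersion property.\<close>

lemma divided_difference_nonzero:
  fixes t p q :: real and a b :: complex
  assumes t: "1 < t" "t < sqrt ((2 + sqrt 2) / 3)" and "0 < p" "0 < q"
    and a: "(cmod a)\<^sup>2 / p + (cmod (1 - a))\<^sup>2 / q + p + q = 2 * t"
    and b: "(cmod b)\<^sup>2 / p + (cmod (1 - b))\<^sup>2 / q + p + q = 2 * t"
  shows "1 - (2 - \<i>) * (a + b) + (1 - \<i>) * (a\<^sup>2 + a * b + b\<^sup>2) \<noteq> 0"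
proof
  assume zero: "1 - (2 - \<i>) * (a + b) + (1 - \<i>) * (a\<^sup>2 + a * b + b\<^sup>2) = 0"
  define m d where "m = (a + b) / 2" and "d = (a - b) / 2"
  \<comment> \<open>\<open>1/2 + \<i>/6\<close> is the inflection point of the cubic, so that no linear term remains.\<close>
  define m' where "m' = m - 1/2 - \<i>/6"
  have ab: "a = m' + 1/2 + \<i>/6 + d" "b = m' + 1/2 + \<i>/6 - d"
    by (simp_all add: m'_def m_def d_def field_simps)
  have "3 * m'\<^sup>2 + d\<^sup>2 = 1/6"
  proof -
    \<comment> \<open>The factor is the inverse of 1 - i.\<close>
    have "(1 + \<i>) / 2 * (1 - (2 - \<i>) * (a + b) + (1 - \<i>) * (a\<^sup>2 + a * b + b\<^sup>2)) = 3 * m'\<^sup>2 + d\<^sup>2 - 1/6"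
      unfolding ab by (simp add: complex_eq_iff power2_eq_square field_simps)
    then show ?thesis
      using zero by simp
  qed
  then have "Re (3 * m'\<^sup>2 + d\<^sup>2) = 1/6" "Im (3 * m'\<^sup>2 + d\<^sup>2) = 0"
    by (simp_all only:) simp_all
  then have re: "3 * ((Re m')\<^sup>2 - (Im m')\<^sup>2) + (Re d)\<^sup>2 - (Im d)\<^sup>2 = 1/6"
    and im: "3 * Re m' * Im m' + Re d * Im d = 0"
    by (simp_all add: Re_power2 Im_power2 algebra_simps)
  define T where "T = t\<^sup>2"
  have T: "1 < T" "T < (2 + sqrt 2) / 3"
  proof -
    show "1 < T"
      using t(1) by (simp add: T_def one_less_power)
    have "t\<^sup>2 < (sqrt ((2 + sqrt 2) / 3))\<^sup>2"
      using t by (intro power_strict_mono) auto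
    also have "\<dots> = (2 + sqrt 2) / 3"
      by (intro real_sqrt_pow2) (simp add: add_nonneg_nonneg)
    finally show "T < (2 + sqrt 2) / 3"
      by (simp add: T_def)
  qed
  \<comment> \<open>With weight 1 - 1/t^2 the quadratic form is the one in
    \<open>fibre_mean_bound\<close>, so its lower and upper bounds can be compared.\<close>
  have "(T - 1) / T / 18 + 1/36 \<le> (T - 1) / T * (Re m')\<^sup>2 + (Im m' + 1/6)\<^sup>2 + (Re d)\<^sup>2 + (Im d)\<^sup>2"
    using T by (intro fibre_inequality re im) auto
  also have "\<dots> \<le> (T - 1) / 4"
    using fibre_mean_bound[OF t(1) \<open>0 < p\<close> \<open>0 < q\<close> a b] by (simp add: m'_def m_def d_def T_def)
  finally have "0 \<le> 9 * T\<^sup>2 - 12 * T + 2"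
    using T by (simp add: field_simps power2_eq_square)
  also have "\<dots> = 9 * (T - (2 + sqrt 2) / 3) * (T - (2 - sqrt 2) / 3)"
    by (simp add: field_simps power2_eq_square)
  also have "\<dots> < 0"
  proof -
    have "0 \<le> sqrt (2::real)"
      by simp
    then have "0 < T - (2 - sqrt 2) / 3"
      using T by simp
    moreover have "9 * (T - (2 + sqrt 2) / 3) < 0"
      using T by simp
    ultimately show ?thesis
      by (simp add: mult_neg_pos)
  qed
  finally show False
    by simp
qed

section \<open>The embedding\<close>

text \<open>In the opening remark these four are z, zeta, w, eta. The coordinate change is sqrt 2
  times a unitary map, whence 2 * t below.\<close>

definition w1 :: "complex ^ 4 \<Rightarrow> complex" where "w1 z = z$1 + \<i> * z$2"
definition w2 :: "complex ^ 4 \<Rightarrow> complex" where "w2 z = z$1 - \<i> * z$2"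
definition w3 :: "complex ^ 4 \<Rightarrow> complex" where "w3 z = z$3 + \<i> * z$4"
definition w4 :: "complex ^ 4 \<Rightarrow> complex" where "w4 z = z$3 - \<i> * z$4"

lemmas w_defs = w1_def w2_def w3_def w4_def

lemma bounded_linear_w:
  "bounded_linear w1" "bounded_linear w2" "bounded_linear w3" "bounded_linear w4"
  unfolding w_defs
  by (intro bounded_linear_add bounded_linear_sub bounded_linear_vec_nth
      bounded_linear_compose[OF bounded_linear_mult_right])+

lemma w_mult_ii:
  "w1 (\<i> *s v) = \<i> * w1 v" "w2 (\<i> *s v) = \<i> * w2 v" "w3 (\<i> *s v) = \<i> * w3 v" "w4 (\<i> *s v) = \<i> * w4 v"
  by (simp_all add: w_defs algebra_simps)

lemma w_inject:
  assumes "w1 y = w1 z" "w2 y = w2 z" "w3 y = w3 z" "w4 y = w4 z"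
  shows "y = z"
proof -
  have "z$1 = (w1 z + w2 z) / 2" "z$2 = (w1 z - w2 z) / (2 * \<i>)"
      "z$3 = (w3 z + w4 z) / 2" "z$4 = (w3 z - w4 z) / (2 * \<i>)" for z
    by (simp_all add: w_defs)
  with assms show ?thesis
    by (simp only: vec_eq_iff forall_4 simp_thms)
qed

lemma M3_w:
  assumes "z \<in> M3 t"
  shows "w1 z * w2 z + w3 z * w4 z = 1"
    and "(cmod (w1 z))\<^sup>2 + (cmod (w2 z))\<^sup>2 + (cmod (w3 z))\<^sup>2 + (cmod (w4 z))\<^sup>2 = 2 * t"
proof -
  have "w1 z * w2 z + w3 z * w4 z = (z$1)\<^sup>2 + (z$2)\<^sup>2 + (z$3)\<^sup>2 + (z$4)\<^sup>2"
    by (simp add: w_defs power2_eq_square algebra_simps)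
  then show "w1 z * w2 z + w3 z * w4 z = 1"
    using assms by (simp add: M3_def Q3_def)
  have "(cmod (x + \<i> * y))\<^sup>2 + (cmod (x - \<i> * y))\<^sup>2 = 2 * ((cmod x)\<^sup>2 + (cmod y)\<^sup>2)" for x y
    unfolding cmod_power2 by (simp add: power2_eq_square algebra_simps)
  from this[of "z$1" "z$2"] this[of "z$3" "z$4"] assms
  show "(cmod (w1 z))\<^sup>2 + (cmod (w2 z))\<^sup>2 + (cmod (w3 z))\<^sup>2 + (cmod (w4 z))\<^sup>2 = 2 * t"
    by (simp add: M3_def w_defs)
qed

text \<open>For fixed nonzero w1 and w3 the product w1 * w2 parametrises the fibre. This is its
  equation in the form that \<open>divided_difference_nonzero\<close> takes.\<close>

lemma M3_fibre:
  assumes "z \<in> M3 t" "w1 z \<noteq> 0" "w3 z \<noteq> 0"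
  shows "(cmod (w1 z * w2 z))\<^sup>2 / (cmod (w1 z))\<^sup>2 + (cmod (1 - w1 z * w2 z))\<^sup>2 / (cmod (w3 z))\<^sup>2
    + (cmod (w1 z))\<^sup>2 + (cmod (w3 z))\<^sup>2 = 2 * t"
proof -
  have "1 - w1 z * w2 z = w3 z * w4 z"
    using M3_w(1)[OF assms(1)] by (simp add: algebra_simps)
  then show ?thesis
    using M3_w(2)[OF assms(1)] assms(2,3) by (simp add: norm_mult power_mult_distrib)
qed

text \<open>The holomorphic extension to \<open>Q3\<close> of the totally real embedding
  \<open>(z, w) \<mapsto> (z, w, cnj z * cnj w * (|w|\<^sup>2 + \<i> |z|\<^sup>2))\<close> of the sphere \<open>S\<^sup>3\<close>; on real points
  \<open>z = w1\<close>, \<open>cnj z = w2\<close>, \<open>w = w3\<close>, \<open>cnj w = w4\<close>.\<close>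

definition ahern_rudin :: "complex ^ 4 \<Rightarrow> complex ^ 3" where
  "ahern_rudin z = vector [w1 z, w3 z, w2 z * w4 z * (w3 z * w4 z + \<i> * (w1 z * w2 z))]"

definition ahern_rudin_deriv :: "complex ^ 4 \<Rightarrow> complex ^ 4 \<Rightarrow> complex ^ 3" where
  "ahern_rudin_deriv z v = vector [w1 v, w3 v,
     (w2 v * w4 z + w2 z * w4 v) * (w3 z * w4 z + \<i> * (w1 z * w2 z)) +
     w2 z * w4 z * (w3 v * w4 z + w3 z * w4 v + \<i> * (w1 v * w2 z + w1 z * w2 v))]"

lemma ahern_rudin_polynomial: "polynomial_function ahern_rudin"
proof (rule polynomial_function_componentwise_vec)
  have w: "polynomial_function w1" "polynomial_function w2" "polynomial_function w3" "polynomial_function w4"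
    by (auto intro: polynomial_function_bounded_linear bounded_linear_w)
  have "polynomial_function (\<lambda>z. w2 z * w4 z * (w3 z * w4 z + \<i> * (w1 z * w2 z)))"
    by (intro polynomial_function_complex_mult polynomial_function_add polynomial_function_const w)
  with w show "polynomial_function (\<lambda>z. ahern_rudin z $ i)" for i
    using exhaust_3[of i] by (auto simp: ahern_rudin_def)
qed

lemma w_has_derivative [derivative_intros]:
  "(w1 has_derivative w1) F" "(w2 has_derivative w2) F" "(w3 has_derivative w3) F" "(w4 has_derivative w4) F"
  by (auto intro: bounded_linear_imp_has_derivative bounded_linear_w)

lemma ahern_rudin_has_derivative:
  "(ahern_rudin has_derivative ahern_rudin_deriv z) (at z within S)"
proof (rule has_derivative_componentwise_vec)
  have "((\<lambda>z. w2 z * w4 z * (w3 z * w4 z + \<i> * (w1 z * w2 z))) has_derivative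
      (\<lambda>v. (w2 v * w4 z + w2 z * w4 v) * (w3 z * w4 z + \<i> * (w1 z * w2 z)) +
     w2 z * w4 z * (w3 v * w4 z + w3 z * w4 v + \<i> * (w1 v * w2 z + w1 z * w2 v)))) (at z within S)"
    by (rule derivative_eq_intros refl)+ (simp add: algebra_simps)
  then show "((\<lambda>z. ahern_rudin z $ i) has_derivative (\<lambda>v. ahern_rudin_deriv z v $ i)) (at z within S)" for i
    using exhaust_3[of i] w_has_derivative by (auto simp: ahern_rudin_def ahern_rudin_deriv_def)
qed

lemma ahern_rudin_deriv_linear: "linear (ahern_rudin_deriv z)"
  using ahern_rudin_has_derivative[of z UNIV] by (rule has_derivative_linear)

text \<open>The map is holomorphic on the whole ambient space; this yields the CR condition.\<close>

lemma ahern_rudin_deriv_mult_ii: "ahern_rudin_deriv z (\<i> *s v) = \<i> *s ahern_rudin_deriv z v"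
  by (simp add: vec_eq_iff forall_3 ahern_rudin_deriv_def w_mult_ii algebra_simps)

lemma ahern_rudin_inj_on:
  assumes t: "1 < t" "t < sqrt ((2 + sqrt 2) / 3)"
  shows "inj_on ahern_rudin (M3 t)"
proof (rule inj_onI)
  fix y z assume y: "y \<in> M3 t" and z: "z \<in> M3 t" and "ahern_rudin y = ahern_rudin z"
  then have "\<forall>i. ahern_rudin y $ i = ahern_rudin z $ i"
    by simp
  then have w13: "w1 y = w1 z" "w3 y = w3 z"
    and third: "w2 y * w4 y * (w3 z * w4 y + \<i> * (w1 z * w2 y)) =
      w2 z * w4 z * (w3 z * w4 z + \<i> * (w1 z * w2 z))"
    by (auto simp: forall_3 ahern_rudin_def)
  note Qy = M3_w(1)[OF y, unfolded w13] and Qz = M3_w(1)[OF z]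
  have "w2 y = w2 z \<and> w4 y = w4 z"
  proof (cases "w1 z = 0 \<or> w3 z = 0")
    \<comment> \<open>Here the quadric fixes one of w2, w4, and the third component becomes a
      nonzero constant times w2 * w4, which fixes the other.\<close>
    case True
    then show ?thesis
    proof
      assume "w1 z = 0"
      with Qy Qz have "w3 z * w4 y = 1" "w3 z * w4 z = 1"
        by simp_all
      moreover from this have "w3 z \<noteq> 0" "w4 z \<noteq> 0"
        by auto
      ultimately show ?thesis
        using third \<open>w1 z = 0\<close> by (metis add.right_neutral mult_cancel_left mult_cancel_right mult_zero_left mult_zero_right)
    next
      assume "w3 z = 0"
      with Qy Qz have "w1 z * w2 y = 1" "w1 z * w2 z = 1"
        by simp_all
      moreover from this have "w1 z \<noteq> 0" "w2 z \<noteq> 0"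
        by auto
      ultimately show ?thesis
        using third \<open>w3 z = 0\<close> by (metis add_0 mult_cancel_left mult_cancel_right mult_zero_left complex_i_not_zero)
    qed
  next
    case False
    define a b where "a = w1 z * w2 y" and "b = w1 z * w2 z"
    have w4: "w3 z * w4 y = 1 - a" "w3 z * w4 z = 1 - b"
      using Qy Qz by (simp_all add: a_def b_def algebra_simps)
    \<comment> \<open>Multiplying \<open>third\<close> by w1 z * w3 z gives equal values of the
      cubic at \<open>a\<close> and \<open>b\<close>; factoring out a - b leaves the divided
      difference.\<close>
    have "a * (1 - a) * ((1 - a) + \<i> * a) = b * (1 - b) * ((1 - b) + \<i> * b)"
      unfolding w4[symmetric] unfolding a_def b_def using third by algebra
    then have "(a - b) * (1 - (2 - \<i>) * (a + b) + (1 - \<i>) * (a\<^sup>2 + a * b + b\<^sup>2)) = 0"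
      by (simp add: power2_eq_square algebra_simps)
    moreover have "1 - (2 - \<i>) * (a + b) + (1 - \<i>) * (a\<^sup>2 + a * b + b\<^sup>2) \<noteq> 0"
      using M3_fibre[OF y] M3_fibre[OF z] False t unfolding w13 a_def b_def
      by (intro divided_difference_nonzero[of t "(cmod (w1 z))\<^sup>2" "(cmod (w3 z))\<^sup>2"]) auto
    ultimately have "a = b"
      by simp
    then show ?thesis
      using w4 False unfolding a_def b_def by (metis mult_cancel_left)
  qed
  with w13 show "y = z"
    by (intro w_inject) auto
qed

lemma ahern_rudin_deriv_inj_on:
  assumes t: "1 < t" "t < sqrt ((2 + sqrt 2) / 3)" and z: "z \<in> M3 t"
  shows "inj_on (ahern_rudin_deriv z) (tangent_space (M3 t) z)"
proof -
  define a where "a = w1 z * w2 z"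
  have w34: "w3 z * w4 z = 1 - a"
    using M3_w(1)[OF z] by (simp add: a_def algebra_simps)
  \<comment> \<open>\<open>D\<close> is the derivative of the cubic at \<open>a\<close>.\<close>
  define D where "D = 1 - (2 - \<i>) * (a + a) + (1 - \<i>) * (a\<^sup>2 + a * a + a\<^sup>2)"
  have D: "D \<noteq> 0"
  proof (cases "w1 z = 0 \<or> w3 z = 0")
    case True
    \<comment> \<open>The derivative of the cubic is 1 at 0 and -i at 1.\<close>
    then have "a = 0 \<or> a = 1"
      using w34 by (auto simp: a_def)
    then show ?thesis
      by (auto simp: D_def complex_eq_iff)
  next
    case False
    then show ?thesis
      using M3_fibre[OF z] t unfolding D_def a_def
      by (intro divided_difference_nonzero[of t "(cmod (w1 z))\<^sup>2" "(cmod (w3 z))\<^sup>2"]) auto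
  qed
  have kernel: "u = v"
    if u: "u \<in> tangent_space (M3 t) z" and v: "v \<in> tangent_space (M3 t) z"
      and eq: "ahern_rudin_deriv z u = ahern_rudin_deriv z v" for u v
  proof -
    have Q: "w1 x * w2 z + w1 z * w2 x + (w3 x * w4 z + w3 z * w4 x) = 0"
      if "x \<in> tangent_space (M3 t) z" for x
      by (rule tangent_space_level_set[OF that, where g = "\<lambda>z. w1 z * w2 z + w3 z * w4 z"])
        (auto intro!: derivative_eq_intros simp: M3_w(1))
    \<comment> \<open>\<open>tangent_space\<close> consists of velocities of curves and is not shown
      to be closed under differences, so \<open>Q\<close> is applied to \<open>u\<close> and
      \<open>v\<close> separately.\<close>
    define h where "h = u - v"
    have wh: "w1 h = w1 u - w1 v" "w2 h = w2 u - w2 v" "w3 h = w3 u - w3 v" "w4 h = w4 u - w4 v"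
      by (simp_all add: h_def w_defs algebra_simps)
    have "ahern_rudin_deriv z h = 0"
      using eq linear_diff[OF ahern_rudin_deriv_linear] by (simp add: h_def)
    then have "\<forall>i. ahern_rudin_deriv z h $ i = 0"
      by simp
    then have h13: "w1 h = 0" "w3 h = 0"
      and third: "(w2 h * w4 z + w2 z * w4 h) * (w3 z * w4 z + \<i> * (w1 z * w2 z)) +
        w2 z * w4 z * (w3 z * w4 h + \<i> * (w1 z * w2 h)) = 0"
      by (auto simp: forall_3 ahern_rudin_deriv_def)
    have Qh: "w1 z * w2 h + w3 z * w4 h = 0"
      using Q[OF u] Q[OF v] h13 unfolding wh by algebra
    \<comment> \<open>Cramer's rule: \<open>Qh\<close> and \<open>third\<close> are a linear system
      in w2 h, w4 h whose determinant is -D.\<close>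
    have "w2 h * D = 0"
      using third Qh w34 unfolding D_def a_def using i_squared by algebra
    moreover have "w4 h * D = 0"
      using third Qh w34 unfolding D_def a_def using i_squared by algebra
    ultimately show "u = v"
      using D h13 unfolding wh by (intro w_inject) auto
  qed
  then show ?thesis
    by (intro inj_onI)
qed

theorem theorem1p1:
  fixes t :: real
  assumes "1 < t" and "t < sqrt ((2 + sqrt 2) / 3)"
  shows "\<exists>f :: complex ^ 4 \<Rightarrow> complex ^ 3. real_analytic_CR_embedding (M3 t) f"
proof
  have "real_analytic_map_on (M3 t) ahern_rudin"
    unfolding real_analytic_map_on_def
    using real_analytic_at_polynomial_function[OF ahern_rudin_polynomial]
    by (intro ballI exI[of _ UNIV] exI[of _ ahern_rudin]) auto
  moreover have "immersion_on (M3 t) ahern_rudin"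
    unfolding immersion_on_def using ahern_rudin_has_derivative ahern_rudin_deriv_inj_on[OF assms] by blast
  moreover have "CR_map_on (M3 t) ahern_rudin"
    unfolding CR_map_on_def using ahern_rudin_has_derivative ahern_rudin_deriv_mult_ii by blast
  ultimately show "real_analytic_CR_embedding (M3 t) ahern_rudin"
    using ahern_rudin_inj_on[OF assms] by (simp add: real_analytic_CR_embedding_def)
qed

end
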